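(* Let $L$ be a bounded distributive lattice, $f\colon L^n\to L$ a polynomial function, and $\alpha\colon 2^{[n]}\to L$ a mapping. Then $\alpha\in\mathrm{DNF}(f)$ if and only if $\bigvee_{J\subseteq I}\alpha(J)=\alpha_f(I)$ for all $I\subseteq[n]$.
   Context: Here $n\geqslant 1$, $[n]=\{1,\ldots,n\}$, $2^{[n]}$ is the set of all subsets of $[n]$, and $0,1$ are the bottom and top elements of $L$. A polynomial function $f\colon L^n\to L$ is a map that can be obtained by composition of the binary operations $\wedge$ and $\vee$, the projections, and the constant functions. For a function $f\colon L^n\to L$, $\mathrm{DNF}(f)$ denotes the set of those maps $\alpha\colon 2^{[n]}\to L$ such that $f(x_1,\ldots,x_n)=\bigvee_{I\subseteq[n]}\big(\alpha(I)\wedge\bigwedge_{i\in I}x_i\big)$ for all $(x_1,\ldots,x_n)\in L^n$ (the empty meet being $1$). For $I\subseteq[n]$, $\mathbf{e}_I\in L^n$ is the tuple whose $i$th component is $1$ if $i\in I$ and $0$ otherwise, and $\alpha_f\colon 2^{[n]}\to L$ is defined by $\alpha_f(I)=f(\mathbf{e}_I)$. *)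

theory Defs
  imports "HOL-Analysis.Finite_Cartesian_Product"
begin

text \<open>
  The index set \<open>[n]\<close> is the universe of a finite type \<open>'n\<close> with \<open>CARD('n) = n\<close> (so that
  \<open>n \<ge> 1\<close>), \<open>L\<^sup>n\<close> is the type \<open>'a ^ 'n\<close>, and \<open>2\<^sup>[\<^sup>n\<^sup>]\<close> is the type \<open>'n set\<close>.
\<close>

inductive lattice_polynomial_function ::
    "('a::{distrib_lattice, bounded_lattice} ^ 'n::finite \<Rightarrow> 'a) \<Rightarrow> bool" where
  proj: "lattice_polynomial_function (\<lambda>x. x $ i)"
| const: "lattice_polynomial_function (\<lambda>x. c)"
| inf: "lattice_polynomial_function f \<Longrightarrow> lattice_polynomial_function g \<Longrightarrow>
    lattice_polynomial_function (\<lambda>x. inf (f x) (g x))"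
| sup: "lattice_polynomial_function f \<Longrightarrow> lattice_polynomial_function g \<Longrightarrow>
    lattice_polynomial_function (\<lambda>x. sup (f x) (g x))"

text \<open>\<^const>\<open>Inf_fin\<close> is unspecified on the empty set; inserting \<^const>\<open>top\<close> makes the empty meet \<^const>\<open>top\<close>.\<close>

definition meet_on :: "'n set \<Rightarrow> 'a::{distrib_lattice, bounded_lattice} ^ 'n::finite \<Rightarrow> 'a" where
  "meet_on I x = Inf_fin (insert top ((\<lambda>i. x $ i) ` I))"

definition DNF ::
    "('a::{distrib_lattice, bounded_lattice} ^ 'n::finite \<Rightarrow> 'a) \<Rightarrow> ('n set \<Rightarrow> 'a) set" where
  "DNF f = {\<alpha>. \<forall>x. f x = Sup_fin ((\<lambda>I. inf (\<alpha> I) (meet_on I x)) ` Pow UNIV)}"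

definition char_vec :: "'n set \<Rightarrow> 'a::{distrib_lattice, bounded_lattice} ^ 'n::finite" where
  "char_vec I = (\<chi> i. if i \<in> I then top else bot)"

definition alpha_of ::
    "('a::{distrib_lattice, bounded_lattice} ^ 'n::finite \<Rightarrow> 'a) \<Rightarrow> 'n set \<Rightarrow> 'a" where
  "alpha_of f I = f (char_vec I)"

end

theory Submission
  imports Defs
begin

text \<open>
  Replacing \<open>\<alpha>\<close> by its monotone hull \<open>I \<mapsto> \<Or>\<^bsub>J \<subseteq> I\<^esub> \<alpha>(J)\<close> does not change the normal form with
  coefficients \<open>\<alpha>\<close>, because \<open>\<And>\<^bsub>i \<in> I\<^esub> x\<^sub>i\<close> decreases as \<open>I\<close> grows; and the value of that normal
  form at \<open>\<^bold>e\<^sub>I\<close> is the value of the hull at \<open>I\<close>. So two normal forms define the same function if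
  and only if their hulls agree, and it remains to see that every polynomial function has a
  normal form. Normal forms are closed under meets because the coefficients may be taken monotone.
\<close>

lemma inf_Sup_fin_image_le_iff:
  fixes f :: "'b \<Rightarrow> 'a::distrib_lattice"
  assumes "finite A" "A \<noteq> {}"
  shows "inf w (Sup_fin (f ` A)) \<le> z \<longleftrightarrow> (\<forall>a\<in>A. inf w (f a) \<le> z)"
proof -
  have "inf w (Sup_fin (f ` A)) = Sup_fin {inf w y |y. y \<in> f ` A}"
    using assms by (simp add: inf_Sup1_distrib)
  also have "{inf w y |y. y \<in> f ` A} = (\<lambda>a. inf w (f a)) ` A"
    by blast
  finally show ?thesis
    using assms by (simp add: Sup_fin.bounded_iff)
qed

lemma le_meet_on_iff: "z \<le> meet_on I x \<longleftrightarrow> (\<forall>i\<in>I. z \<le> x $ i)"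
  unfolding meet_on_def by (subst Inf_fin.bounded_iff) auto

lemma meet_on_le: "i \<in> I \<Longrightarrow> meet_on I x \<le> x $ i"
  using le_meet_on_iff by blast

lemma meet_on_antimono: "J \<subseteq> I \<Longrightarrow> meet_on I x \<le> meet_on J x"
  unfolding le_meet_on_iff by (blast intro: meet_on_le)

lemma meet_on_Un: "meet_on (I \<union> J) x = inf (meet_on I x) (meet_on J x)"
proof (rule order.antisym)
  show "meet_on (I \<union> J) x \<le> inf (meet_on I x) (meet_on J x)"
    by (simp add: meet_on_antimono)
  show "inf (meet_on I x) (meet_on J x) \<le> meet_on (I \<union> J) x"
    unfolding le_meet_on_iff by (blast intro: le_infI1 le_infI2 meet_on_le)
qed

lemma meet_on_empty: "meet_on {} x = top"
  by (simp add: meet_on_def)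

lemma meet_on_singleton: "meet_on {i} x = x $ i"
  by (simp add: meet_on_def)

lemma meet_on_char_vec: "meet_on J (char_vec I) = (if J \<subseteq> I then top else bot)"
proof (cases "J \<subseteq> I")
  case True
  then have "top \<le> meet_on J (char_vec I)"
    unfolding le_meet_on_iff by (auto simp: char_vec_def)
  with True show ?thesis
    by (simp add: top_unique)
next
  case False
  then obtain i where "i \<in> J" "i \<notin> I"
    by blast
  then have "meet_on J (char_vec I) \<le> bot"
    using meet_on_le[of i J "char_vec I"] by (simp add: char_vec_def)
  with False show ?thesis
    by (simp add: bot_unique)
qed

definition monotone_hull :: "('n::finite set \<Rightarrow> 'a::lattice) \<Rightarrow> 'n set \<Rightarrow> 'a" where
  "monotone_hull \<alpha> I = Sup_fin (\<alpha> ` Pow I)"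

lemma monotone_hull_le_iff: "monotone_hull \<alpha> I \<le> z \<longleftrightarrow> (\<forall>J\<subseteq>I. \<alpha> J \<le> z)"
  unfolding monotone_hull_def by (subst Sup_fin.bounded_iff) auto

lemma inf_monotone_hull_le_iff:
  fixes \<alpha> :: "'n::finite set \<Rightarrow> 'a::distrib_lattice"
  shows "inf w (monotone_hull \<alpha> I) \<le> z \<longleftrightarrow> (\<forall>J\<subseteq>I. inf w (\<alpha> J) \<le> z)"
  unfolding monotone_hull_def by (subst inf_Sup_fin_image_le_iff) auto

lemma le_monotone_hull: "J \<subseteq> I \<Longrightarrow> \<alpha> J \<le> monotone_hull \<alpha> I"
  using monotone_hull_le_iff by blast

lemma mono_monotone_hull: "mono (monotone_hull \<alpha>)"
  by (rule monoI) (auto simp: monotone_hull_le_iff intro: le_monotone_hull)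

definition normal_form ::
    "('n::finite set \<Rightarrow> 'a::{distrib_lattice, bounded_lattice}) \<Rightarrow> 'a ^ 'n \<Rightarrow> 'a" where
  "normal_form \<alpha> x = Sup_fin (range (\<lambda>I. inf (\<alpha> I) (meet_on I x)))"

lemma mem_DNF_iff: "\<alpha> \<in> DNF f \<longleftrightarrow> f = normal_form \<alpha>"
  by (simp add: DNF_def normal_form_def fun_eq_iff)

lemma normal_form_le_iff:
  "normal_form \<alpha> x \<le> z \<longleftrightarrow> (\<forall>I. inf (\<alpha> I) (meet_on I x) \<le> z)"
  unfolding normal_form_def by (subst Sup_fin.bounded_iff) auto

lemma inf_normal_form_le_iff:
  "inf w (normal_form \<alpha> x) \<le> z \<longleftrightarrow> (\<forall>I. inf w (inf (\<alpha> I) (meet_on I x)) \<le> z)"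
  unfolding normal_form_def by (subst inf_Sup_fin_image_le_iff) auto

lemma inf_meet_on_le_normal_form: "inf (\<alpha> I) (meet_on I x) \<le> normal_form \<alpha> x"
  using normal_form_le_iff by blast

lemma normal_form_mono:
  assumes "\<And>I. \<alpha> I \<le> \<beta> I"
  shows "normal_form \<alpha> x \<le> normal_form \<beta> x"
  unfolding normal_form_le_iff
  using assms by (blast intro: order_trans[OF inf_mono inf_meet_on_le_normal_form])

lemma normal_form_char_vec: "normal_form \<alpha> (char_vec I) = monotone_hull \<alpha> I"
proof (rule order.antisym)
  show "normal_form \<alpha> (char_vec I) \<le> monotone_hull \<alpha> I"
    by (simp add: normal_form_le_iff meet_on_char_vec le_monotone_hull)
  have "\<alpha> J \<le> normal_form \<alpha> (char_vec I)" if "J \<subseteq> I" for J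
    using inf_meet_on_le_normal_form[of \<alpha> J "char_vec I"] that by (simp add: meet_on_char_vec)
  then show "monotone_hull \<alpha> I \<le> normal_form \<alpha> (char_vec I)"
    by (simp add: monotone_hull_le_iff)
qed

lemma alpha_of_normal_form: "alpha_of (normal_form \<alpha>) = monotone_hull \<alpha>"
  by (simp add: fun_eq_iff alpha_of_def normal_form_char_vec)

lemma normal_form_monotone_hull: "normal_form (monotone_hull \<alpha>) = normal_form \<alpha>"
proof (rule ext, rule order.antisym)
  fix x
  have "inf (meet_on I x) (\<alpha> J) \<le> normal_form \<alpha> x" if "J \<subseteq> I" for I J
  proof -
    have "inf (meet_on I x) (\<alpha> J) \<le> inf (\<alpha> J) (meet_on J x)"
      unfolding inf_commute[of "meet_on I x"]
      using meet_on_antimono[OF that] by (rule inf_mono[OF order_refl])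
    also have "\<dots> \<le> normal_form \<alpha> x"
      by (rule inf_meet_on_le_normal_form)
    finally show ?thesis .
  qed
  then show "normal_form (monotone_hull \<alpha>) x \<le> normal_form \<alpha> x"
    unfolding normal_form_le_iff inf_commute[of "monotone_hull \<alpha> _"] inf_monotone_hull_le_iff
    by blast
  show "normal_form \<alpha> x \<le> normal_form (monotone_hull \<alpha>) x"
    by (simp add: normal_form_mono le_monotone_hull)
qed

lemma normal_form_component: "normal_form (\<lambda>I. if i \<in> I then top else bot) x = x $ i"
proof (rule order.antisym)
  show "normal_form (\<lambda>I. if i \<in> I then top else bot) x \<le> x $ i"
    by (simp add: normal_form_le_iff meet_on_le)
  show "x $ i \<le> normal_form (\<lambda>I. if i \<in> I then top else bot) x"
    using inf_meet_on_le_normal_form[of "\<lambda>I. if i \<in> I then top else bot" "{i}" x]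
    by (simp add: meet_on_singleton)
qed

lemma normal_form_const: "normal_form (\<lambda>I. c) x = c"
proof (rule order.antisym)
  show "normal_form (\<lambda>I. c) x \<le> c"
    by (simp add: normal_form_le_iff)
  show "c \<le> normal_form (\<lambda>I. c) x"
    using inf_meet_on_le_normal_form[of "\<lambda>I. c" "{}" x] by (simp add: meet_on_empty)
qed

lemma normal_form_sup:
  "normal_form (\<lambda>I. sup (\<alpha> I) (\<beta> I)) x = sup (normal_form \<alpha> x) (normal_form \<beta> x)"
proof (rule order.antisym)
  show "normal_form (\<lambda>I. sup (\<alpha> I) (\<beta> I)) x \<le> sup (normal_form \<alpha> x) (normal_form \<beta> x)"
    unfolding normal_form_le_iff inf_sup_distrib2
    by (blast intro: sup_mono inf_meet_on_le_normal_form)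
  show "sup (normal_form \<alpha> x) (normal_form \<beta> x) \<le> normal_form (\<lambda>I. sup (\<alpha> I) (\<beta> I)) x"
    by (simp add: normal_form_mono)
qed

lemma normal_form_inf:
  assumes "mono \<alpha>" "mono \<beta>"
  shows "normal_form (\<lambda>I. inf (\<alpha> I) (\<beta> I)) x = inf (normal_form \<alpha> x) (normal_form \<beta> x)"
proof (rule order.antisym)
  let ?\<gamma> = "\<lambda>I. inf (\<alpha> I) (\<beta> I)"
  show "normal_form ?\<gamma> x \<le> inf (normal_form \<alpha> x) (normal_form \<beta> x)"
    by (simp add: normal_form_mono)
  have "inf (inf (\<alpha> I) (meet_on I x)) (inf (\<beta> J) (meet_on J x)) \<le> normal_form ?\<gamma> x" for I J
  proof -
    have "inf (inf (\<alpha> I) (meet_on I x)) (inf (\<beta> J) (meet_on J x)) =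
        inf (inf (\<alpha> I) (\<beta> J)) (meet_on (I \<union> J) x)"
      by (simp add: meet_on_Un ac_simps)
    also have "\<dots> \<le> inf (?\<gamma> (I \<union> J)) (meet_on (I \<union> J) x)"
      by (intro inf_mono monoD[OF assms(1)] monoD[OF assms(2)]) auto
    also have "\<dots> \<le> normal_form ?\<gamma> x"
      by (rule inf_meet_on_le_normal_form)
    finally show ?thesis .
  qed
  then have "inf (normal_form \<beta> x) (inf (\<alpha> I) (meet_on I x)) \<le> normal_form ?\<gamma> x" for I
    unfolding inf_commute[of "normal_form \<beta> x"] inf_normal_form_le_iff by blast
  then show "inf (normal_form \<alpha> x) (normal_form \<beta> x) \<le> normal_form ?\<gamma> x"
    unfolding inf_commute[of "normal_form \<alpha> x"] inf_normal_form_le_iff by blast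
qed

lemma lattice_polynomial_function_ex_normal_form:
  assumes "lattice_polynomial_function f"
  shows "\<exists>\<alpha>. f = normal_form \<alpha>"
  using assms
proof (induction rule: lattice_polynomial_function.induct)
  case (proj i)
  have "(\<lambda>x. x $ i) = normal_form (\<lambda>I. if i \<in> I then top else bot)"
    by (simp add: fun_eq_iff normal_form_component)
  then show ?case
    by blast
next
  case (const c)
  have "(\<lambda>x. c) = normal_form (\<lambda>I. c)"
    by (simp add: fun_eq_iff normal_form_const)
  then show ?case
    by blast
next
  case (inf f g)
  then obtain \<alpha> \<beta> where "f = normal_form \<alpha>" "g = normal_form \<beta>"
    by blast
  then have "(\<lambda>x. inf (f x) (g x)) =
      normal_form (\<lambda>I. inf (monotone_hull \<alpha> I) (monotone_hull \<beta> I))"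
    by (simp add: fun_eq_iff normal_form_inf mono_monotone_hull normal_form_monotone_hull)
  then show ?case
    by blast
next
  case (sup f g)
  then obtain \<alpha> \<beta> where "f = normal_form \<alpha>" "g = normal_form \<beta>"
    by blast
  then have "(\<lambda>x. sup (f x) (g x)) = normal_form (\<lambda>I. sup (\<alpha> I) (\<beta> I))"
    by (simp add: fun_eq_iff normal_form_sup)
  then show ?case
    by blast
qed

theorem normal_form_alpha_of:
  assumes "lattice_polynomial_function f"
  shows "normal_form (alpha_of f) = f"
proof -
  obtain \<alpha> where "f = normal_form \<alpha>"
    using lattice_polynomial_function_ex_normal_form[OF assms] ..
  then show ?thesis
    by (simp add: alpha_of_normal_form normal_form_monotone_hull)
qed

theorem proposition3:
  fixes f :: "'a::{distrib_lattice, bounded_lattice} ^ 'n::finite \<Rightarrow> 'a"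
    and \<alpha> :: "'n set \<Rightarrow> 'a"
  assumes "lattice_polynomial_function f"
  shows "\<alpha> \<in> DNF f \<longleftrightarrow> (\<forall>I. Sup_fin (\<alpha> ` Pow I) = alpha_of f I)"
proof -
  have "f = normal_form \<alpha> \<longleftrightarrow> monotone_hull \<alpha> = alpha_of f"
  proof
    assume "f = normal_form \<alpha>"
    then show "monotone_hull \<alpha> = alpha_of f"
      by (simp add: alpha_of_normal_form)
  next
    assume hull: "monotone_hull \<alpha> = alpha_of f"
    have "f = normal_form (alpha_of f)"
      using assms by (simp add: normal_form_alpha_of)
    also have "\<dots> = normal_form \<alpha>"
      by (simp flip: hull add: normal_form_monotone_hull)
    finally show "f = normal_form \<alpha>" .
  qed
  then show ?thesis
    by (simp add: mem_DNF_iff fun_eq_iff monotone_hull_def)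
qed

end
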